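(* Let $q$ be a prime power, $n$ a positive integer, and let $\mathcal{U}=\{\vec{u}_1,\ldots,\vec{u}_n\}$, $\mathcal{V}=\{\vec{v}_1,\ldots,\vec{v}_n\}$, $\mathcal{W}=\{\vec{w}_1,\ldots,\vec{w}_n\}$ be three (possibly different) ordered bases of $\mathbb{F}_q^n$ over $\mathbb{F}_q$. Let $\mathcal{I}=\{1,\ldots,n\}$ and let $D\subseteq\mathbb{F}_q^n$ be a linear subspace. Then $$\#\mathrm{Supp}\,D\ \geq\ \max\{\#\mathcal{I}' \mid \mathcal{I}'\subseteq\mathcal{I},\ \mathcal{I}' \text{ has the } \mu\text{-property with respect to } m(D)\}.$$
   Context: Notation. For $\vec{u},\vec{v}\in\mathbb{F}_q^n$, $\vec{u}\ast\vec{v}=(u_1v_1,\ldots,u_nv_n)$ is the componentwise product and $\vec{u}\cdot\vec{v}=\sum_i u_iv_i$ the usual inner product. The support of a subspace $D$ is $\mathrm{Supp}\,D=\{i\mid c_i\neq 0 \text{ for some } \vec{c}\in D\}$. The function $\bar{\rho}_{\mathcal{W}}:\mathbb{F}_q^n\to\{0,1,\ldots,n\}$ is given by $\bar{\rho}_{\mathcal{W}}(\vec{0})=0$ and, for $\vec{c}\neq\vec{0}$, $\bar{\rho}_{\mathcal{W}}(\vec{c})=i$ if $\vec{c}\in\mathrm{Span}\{\vec{w}_1,\ldots,\vec{w}_i\}\setminus\mathrm{Span}\{\vec{w}_1,\ldots,\vec{w}_{i-1}\}$ (with $\mathrm{Span}\,\emptyset=\{\vec{0}\}$). For $\vec{c}\neq\vec{0}$,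 $m(\vec{c})$ is the smallest $l\in\mathcal{I}$ with $\vec{c}\cdot\vec{w}_l\neq 0$. For a subspace $D$, $m(D)=\{m(\vec{c})\mid\vec{c}\in D\setminus\{\vec{0}\}\}$. For $\mathcal{I}'\subseteq\mathcal{I}$, a pair $(i,j)\in\mathcal{I}'\times\mathcal{I}$ is one-way well-behaving (OWB) with respect to $\mathcal{I}'$ if $\bar{\rho}_{\mathcal{W}}(\vec{u}_{i'}\ast\vec{v}_j)<\bar{\rho}_{\mathcal{W}}(\vec{u}_i\ast\vec{v}_j)$ for all $i'\in\mathcal{I}'$ with $i'<i$. The set $\mathcal{I}'\subseteq\mathcal{I}$ has the $\mu$-property with respect to a set $\{l_1,\ldots,l_t\}\subseteq\mathcal{I}$ if for all $i\in\mathcal{I}'$ there exists $j\in\mathcal{I}$ such that $(i,j)$ is OWB with respect to $\mathcal{I}'$ and $\bar{\rho}_{\mathcal{W}}(\vec{u}_i\ast\vec{v}_j)\in\{l_1,\ldots,l_t\}$. *)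

theory Defs
  imports "HOL-Analysis.Analysis"
begin

(* The space F_q^n is 'a^'n with 'a a finite field and n = CARD('n).  Ordered families are
   functions on nat, of which only the values at 1, ..., CARD('n) matter.  The componentwise
   product of vectors is the library's multiplication on 'a^'n. *)

definition ordered_basis :: "(nat \<Rightarrow> 'a::field ^ 'n) \<Rightarrow> bool" where
  "ordered_basis u \<longleftrightarrow>
     inj_on u {1..CARD('n)} \<and>
     vec.independent (u ` {1..CARD('n)}) \<and>
     vec.span (u ` {1..CARD('n)}) = UNIV"

(* The library's inner product is confined to real vector spaces. *)
definition dot :: "'a::field ^ 'n \<Rightarrow> 'a ^ 'n \<Rightarrow> 'a" where
  "dot x y = (\<Sum>k\<in>UNIV. x $ k * y $ k)"

definition Supp :: "('a::field ^ 'n) set \<Rightarrow> 'n set" where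
  "Supp D = {k. \<exists>c\<in>D. c $ k \<noteq> 0}"

(* For an ordered basis w and c \<noteq> 0 such an i exists, as the spans increase from {0}
   to the whole space, and it is unique, as they are nested. *)
definition rho_bar :: "(nat \<Rightarrow> 'a::field ^ 'n) \<Rightarrow> 'a ^ 'n \<Rightarrow> nat" where
  "rho_bar w c =
     (if c = 0 then 0
      else THE i. i \<in> {1..CARD('n)} \<and> c \<in> vec.span (w ` {1..i}) - vec.span (w ` {1..i - 1}))"

(* Meaningful for c \<noteq> 0 only; if w is an ordered basis, such an l then exists. *)
definition m_elem :: "(nat \<Rightarrow> 'a::field ^ 'n) \<Rightarrow> 'a ^ 'n \<Rightarrow> nat" where
  "m_elem w c = (LEAST l. l \<in> {1..CARD('n)} \<and> dot c (w l) \<noteq> 0)"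

definition m_space :: "(nat \<Rightarrow> 'a::field ^ 'n) \<Rightarrow> ('a ^ 'n) set \<Rightarrow> nat set" where
  "m_space w D = m_elem w ` (D - {0})"

definition OWB ::
  "(nat \<Rightarrow> 'a::field ^ 'n) \<Rightarrow> (nat \<Rightarrow> 'a ^ 'n) \<Rightarrow> (nat \<Rightarrow> 'a ^ 'n) \<Rightarrow> nat set \<Rightarrow> nat \<Rightarrow> nat \<Rightarrow> bool"
  where
  "OWB u v w I' i j \<longleftrightarrow>
     i \<in> I' \<and> j \<in> {1..CARD('n)} \<and>
     (\<forall>i'\<in>I'. i' < i \<longrightarrow> rho_bar w (u i' * v j) < rho_bar w (u i * v j))"

definition mu_property ::
  "(nat \<Rightarrow> 'a::field ^ 'n) \<Rightarrow> (nat \<Rightarrow> 'a ^ 'n) \<Rightarrow> (nat \<Rightarrow> 'a ^ 'n) \<Rightarrow> nat set \<Rightarrow> nat set \<Rightarrow> bool"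
  where
  "mu_property u v w I' L \<longleftrightarrow>
     (\<forall>i\<in>I'. \<exists>j\<in>{1..CARD('n)}. OWB u v w I' i j \<and> rho_bar w (u i * v j) \<in> L)"

end

theory Submission
  imports Defs
begin

text \<open>
  If \<open>I'\<close> has the \<open>\<mu>\<close>-property with respect to \<open>m(D)\<close>, no nonzero \<open>x\<close> in the span of the
  \<open>u\<^sub>i\<close>, \<open>i \<in> I'\<close>, vanishes on the support of \<open>D\<close>. Indeed, if \<open>u\<^sub>i\<close> is the leading term of \<open>x\<close>, choose
  \<open>j\<close> with \<open>(i, j)\<close> OWB and \<open>c \<in> D\<close> with \<open>m(c) = \<rho>(u\<^sub>i * v\<^sub>j)\<close>. By OWB, \<open>x * v\<^sub>j\<close> has the leading
  \<open>w\<close>-index \<open>m(c)\<close>, so the inner product of \<open>c\<close> with \<open>x * v\<^sub>j\<close> is nonzero. Restriction of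
  coordinates to the support of \<open>D\<close> is therefore injective on a space of dimension \<open>card I'\<close>.
\<close>

text \<open>The set \<open>A\<close> is built up by adding its largest index \<open>b\<close>:
  either \<open>u b\<close> occurs with a nonzero coefficient and leads, or \<open>x\<close> already
  lies in the span for the smaller indices.\<close>

lemma span_leading_term:
  fixes u :: "nat \<Rightarrow> 'a::field ^ 'n"
  assumes "finite A" and "x \<in> vec.span (u ` A)" and "x \<noteq> 0"
  shows "\<exists>i\<in>A. \<exists>a. a \<noteq> 0 \<and> x - a *s u i \<in> vec.span (u ` {i'\<in>A. i' < i})"
  using assms
proof (induction A rule: finite_linorder_max_induct)
  case empty
  then show ?case by simp
next
  case (insert b A)
  obtain k where k: "x - k *s u b \<in> vec.span (u ` A)"
    using insert.prems(1) by (auto simp: vec.span_insert)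
  have below_b: "{i'\<in>insert b A. i' < b} = A"
    using insert.hyps by auto
  show ?case
  proof (cases "k = 0")
    case True
    then have "x \<in> vec.span (u ` A)" using k by simp
    then obtain i a where ia: "i \<in> A" "a \<noteq> 0" "x - a *s u i \<in> vec.span (u ` {i'\<in>A. i' < i})"
      using insert.IH insert.prems by blast
    have "{i'\<in>insert b A. i' < i} = {i'\<in>A. i' < i}"
      using ia(1) insert.hyps by (auto dest: less_asym)
    then have "x - a *s u i \<in> vec.span (u ` {i'\<in>insert b A. i' < i})"
      using ia(3) by simp
    then show ?thesis using ia(1,2) by blast
  next
    case False
    moreover have "x - k *s u b \<in> vec.span (u ` {i'\<in>insert b A. i' < b})"
      using k by (simp only: below_b)
    ultimately show ?thesis by blast
  qed
qed

lemma rho_bar_nonzero: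
  fixes w :: "nat \<Rightarrow> 'a::field ^ 'n"
  assumes "ordered_basis w" and "y \<noteq> 0"
  shows "rho_bar w y \<in> {1..CARD('n)}"
    and "y \<in> vec.span (w ` {1..rho_bar w y}) - vec.span (w ` {1..rho_bar w y - 1})"
proof -
  let ?P = "\<lambda>i. i \<in> {1..CARD('n)} \<and> y \<in> vec.span (w ` {1..i}) - vec.span (w ` {1..i - 1})"
  let ?Q = "\<lambda>i. y \<in> vec.span (w ` {1..i})"
  define l where "l = (LEAST i. ?Q i)"
  have top: "?Q CARD('n)" using assms(1) by (simp add: ordered_basis_def)
  have Ql: "?Q l" unfolding l_def by (rule LeastI[of ?Q, OF top])
  \<comment> \<open>\<open>{1..0}\<close> is empty and spans only the zero vector. With
    \<open>l\<close> positive, \<open>l - 1\<close> is a genuine predecessor, to which minimality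
    applies.\<close>
  have "l \<noteq> 0"
  proof
    assume "l = 0"
    then show False using Ql assms(2) by simp
  qed
  moreover have "l \<le> CARD('n)" unfolding l_def by (rule Least_le[of ?Q, OF top])
  moreover have "\<not> ?Q (l - 1)"
    unfolding l_def by (rule not_less_Least) (use \<open>l \<noteq> 0\<close> in \<open>simp add: l_def\<close>)
  ultimately have "?P l" using Ql by simp
  moreover have "i = i'" if "?P i" "?P i'" for i i'
  proof -
    have "\<not> i < i'" if P: "?P i" "?P i'" for i i'
    proof
      assume "i < i'"
      then have "w ` {1..i} \<subseteq> w ` {1..i' - 1}" by (intro image_mono) auto
      then show False using P vec.span_mono by blast
    qed
    then show ?thesis using that by (meson linorder_neqE_nat)
  qed
  ultimately have "?P (THE i. ?P i)" by (intro theI'[of ?P]) blast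
  then have "?P (rho_bar w y)" using assms(2) by (simp add: rho_bar_def)
  then show "rho_bar w y \<in> {1..CARD('n)}"
    and "y \<in> vec.span (w ` {1..rho_bar w y}) - vec.span (w ` {1..rho_bar w y - 1})"
    by blast+
qed

lemma rho_bar_less_imp_in_span:
  fixes w :: "nat \<Rightarrow> 'a::field ^ 'n"
  assumes "ordered_basis w" and "rho_bar w y < l"
  shows "y \<in> vec.span (w ` {1..l - 1})"
\<comment> \<open>The value 0 of \<open>rho_bar\<close> at the zero vector is a convention, so this
  case does not come from the spans.\<close>
proof (cases "y = 0")
  case True
  then show ?thesis by (simp add: vec.span_zero)
next
  case False
  have "w ` {1..rho_bar w y} \<subseteq> w ` {1..l - 1}"
    using assms(2) by (intro image_mono) auto
  then show ?thesis using rho_bar_nonzero(2)[OF assms(1) False] vec.span_mono by blast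
qed

lemma dot_add: "dot c (x + y) = dot c x + dot c y"
  by (simp add: dot_def distrib_left sum.distrib)

lemma dot_scale: "dot c (k *s x) = k * dot c x"
  by (simp add: dot_def sum_distrib_left mult.left_commute)

lemma dot_axis: "dot c (axis k 1) = c $ k"
  by (simp add: dot_def axis_def if_distrib cong: if_cong)

lemma dot_span_eq_0:
  assumes "x \<in> vec.span S" and "\<And>s. s \<in> S \<Longrightarrow> dot c s = 0"
  shows "dot c x = 0"
  using assms(1)
proof (induction rule: vec.span_induct_alt)
  case base
  then show ?case by (simp add: dot_def)
next
  case (step k s z)
  then show ?case using assms(2) by (simp add: dot_add dot_scale)
qed

text \<open>A vector orthogonal to all \<open>w l\<close> is orthogonal to their span, the whole
  space, hence to the unit vectors, which read off its coordinates.\<close>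

lemma m_elem_nonzero:
  fixes w :: "nat \<Rightarrow> 'a::field ^ 'n"
  assumes "ordered_basis w" and "c \<noteq> 0"
  shows "m_elem w c \<in> {1..CARD('n)} \<and> dot c (w (m_elem w c)) \<noteq> 0"
proof -
  have "\<exists>l. l \<in> {1..CARD('n)} \<and> dot c (w l) \<noteq> 0"
  proof (rule ccontr)
    assume "\<nexists>l. l \<in> {1..CARD('n)} \<and> dot c (w l) \<noteq> 0"
    then have "dot c x = 0" for x
      using assms(1) by (intro dot_span_eq_0[of x "w ` {1..CARD('n)}"])
        (auto simp: ordered_basis_def)
    then have "c $ k = 0" for k by (metis dot_axis)
    then show False using assms(2) by (simp add: vec_eq_iff)
  qed
  then show ?thesis unfolding m_elem_def by (rule LeastI_ex)
qed

lemma dot_span_below_m_elem: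
  fixes w :: "nat \<Rightarrow> 'a::field ^ 'n"
  assumes "ordered_basis w" and "c \<noteq> 0" and "x \<in> vec.span (w ` {1..m_elem w c - 1})"
  shows "dot c x = 0"
proof (rule dot_span_eq_0[OF assms(3)])
  fix s assume "s \<in> w ` {1..m_elem w c - 1}"
  then obtain l where l: "l \<in> {1..m_elem w c - 1}" "s = w l" by blast
  then have "l < m_elem w c" "l \<in> {1..CARD('n)}"
    using m_elem_nonzero[OF assms(1,2)] by auto
  then show "dot c s = 0"
    using l(2) not_less_Least unfolding m_elem_def by blast
qed

text \<open>Modulo the span of the earlier basis vectors, \<open>y\<close> is a nonzero multiple of
  \<open>w (m_elem w c)\<close>; \<open>c\<close> annihilates that span but not this vector.\<close>

lemma dot_nonzero_if_rho_bar_eq_m_elem: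
  fixes w :: "nat \<Rightarrow> 'a::field ^ 'n"
  assumes w: "ordered_basis w" and c: "c \<noteq> 0" and y: "rho_bar w y = m_elem w c"
  shows "dot c y \<noteq> 0"
proof -
  let ?l = "m_elem w c"
  have l: "?l \<in> {1..CARD('n)}" "dot c (w ?l) \<noteq> 0"
    using m_elem_nonzero[OF w c] by blast+
  \<comment> \<open>\<open>rho_bar\<close> is 0 at the zero vector, while \<open>m_elem w c\<close>
    is at least 1.\<close>
  then have "y \<noteq> 0" using y by (auto simp: rho_bar_def)
  then have in_span: "y \<in> vec.span (w ` {1..?l})" and not_in: "y \<notin> vec.span (w ` {1..?l - 1})"
    using rho_bar_nonzero(2)[OF w] y by force+
  have "{1..?l} = insert ?l {1..?l - 1}" using l(1) by auto
  then obtain k where k: "y - k *s w ?l \<in> vec.span (w ` {1..?l - 1})"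
    using in_span by (auto simp: vec.span_insert)
  then have "k \<noteq> 0" using not_in by auto
  have "dot c y = dot c (y - k *s w ?l) + k * dot c (w ?l)"
    by (simp flip: dot_scale dot_add)
  then show ?thesis
    using dot_span_below_m_elem[OF w c k] \<open>k \<noteq> 0\<close> l(2) by simp
qed

text \<open>Componentwise multiplication by \<open>v\<close> is linear, so generators
  suffice.\<close>

lemma mult_in_span:
  fixes v :: "'a::field ^ 'n"
  assumes "x \<in> vec.span S" and "\<And>s. s \<in> S \<Longrightarrow> s * v \<in> vec.span T"
  shows "x * v \<in> vec.span T"
  using assms(1)
proof (induction rule: vec.span_induct_alt)
  case base
  then show ?case by (simp add: vec.span_zero)
next
  case (step k s z)
  have "(k *s s + z) * v = k *s (s * v) + z * v"
    by (simp add: vec_eq_iff algebra_simps)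
  then show ?case using step assms(2) by (simp add: vec.span_add vec.span_scale)
qed

lemma mu_property_span_meets_Supp:
  fixes u v w :: "nat \<Rightarrow> 'a::field ^ 'n"
  assumes w: "ordered_basis w" and I': "finite I'" and mu: "mu_property u v w I' (m_space w D)"
    and x: "x \<in> vec.span (u ` I')" "x \<noteq> 0"
  shows "\<exists>k\<in>Supp D. x $ k \<noteq> 0"
proof -
  obtain i a where i: "i \<in> I'" and a: "a \<noteq> 0"
    and lower: "x - a *s u i \<in> vec.span (u ` {i'\<in>I'. i' < i})"
    using span_leading_term[OF I' x] by blast
  obtain j where owb: "OWB u v w I' i j" and "rho_bar w (u i * v j) \<in> m_space w D"
    using mu i unfolding mu_property_def by blast
  then obtain c where c: "c \<in> D" "c \<noteq> 0" and rho: "rho_bar w (u i * v j) = m_elem w c"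
    unfolding m_space_def by blast
  have "(x - a *s u i) * v j \<in> vec.span (w ` {1..m_elem w c - 1})"
  proof (rule mult_in_span[OF lower])
    fix s assume "s \<in> u ` {i'\<in>I'. i' < i}"
    then have "rho_bar w (s * v j) < m_elem w c"
      using owb rho unfolding OWB_def by auto
    then show "s * v j \<in> vec.span (w ` {1..m_elem w c - 1})"
      by (rule rho_bar_less_imp_in_span[OF w])
  qed
  then have "dot c ((x - a *s u i) * v j) = 0"
    by (rule dot_span_below_m_elem[OF w c(2)])
  moreover have "x * v j = (x - a *s u i) * v j + a *s (u i * v j)"
    by (simp add: vec_eq_iff algebra_simps)
  ultimately have "dot c (x * v j) \<noteq> 0"
    using dot_nonzero_if_rho_bar_eq_m_elem[OF w c(2) rho] a by (simp add: dot_add dot_scale)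
  \<comment> \<open>In a nonzero summand both \<open>c $ k\<close> and \<open>x $ k\<close> are
    nonzero; the former puts \<open>k\<close> into \<open>Supp D\<close>.\<close>
  then obtain k where "c $ k * (x * v j) $ k \<noteq> 0"
    unfolding dot_def by (meson sum.not_neutral_contains_not_neutral)
  then show ?thesis using c(1) by (auto simp: Supp_def)
qed

lemma independent_card_le_of_coordinates:
  fixes S :: "('a::field ^ 'n) set"
  assumes indep: "vec.independent S"
    and meets: "\<And>x. x \<in> vec.span S \<Longrightarrow> x \<noteq> 0 \<Longrightarrow> \<exists>k\<in>K. x $ k \<noteq> 0"
  shows "card S \<le> card K"
proof -
  \<comment> \<open>Restriction to the coordinates in \<open>K\<close>, padded with zeros to stay in
    the same space; its image is spanned by the unit vectors indexed by \<open>K\<close>.\<close>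
  define p :: "'a ^ 'n \<Rightarrow> 'a ^ 'n" where "p x = (\<chi> k. if k \<in> K then x $ k else 0)" for x
  have lin: "Vector_Spaces.linear (*s) (*s) p"
    by unfold_locales (auto simp: p_def vec_eq_iff algebra_simps)
  have inj: "inj_on p (vec.span S)"
  proof (rule inj_onI)
    fix x y assume xy: "x \<in> vec.span S" "y \<in> vec.span S" and eq: "p x = p y"
    have "x $ k = y $ k" if "k \<in> K" for k
      using arg_cong[OF eq, of "\<lambda>z. z $ k"] that by (simp add: p_def)
    \<comment> \<open>The difference \<open>x - y\<close> lies in the span and vanishes on
      \<open>K\<close>, so it is zero.\<close>
    then show "x = y"
      using meets[OF vec.span_diff[OF xy]] by auto
  qed
  have "p x \<in> vec.span ((\<lambda>k. axis k 1) ` K)" for x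
  proof -
    have "p x = (\<Sum>k\<in>K. x $ k *s axis k 1)"
      by (simp add: p_def vec_eq_iff axis_def if_distrib cong: if_cong)
    also have "\<dots> \<in> vec.span ((\<lambda>k. axis k 1) ` K)"
      by (intro vec.span_sum vec.span_scale vec.span_base imageI)
    finally show ?thesis .
  qed
  moreover have "vec.independent (p ` S)"
    by (rule vec.linear_independent_injective_image[OF lin indep inj])
  ultimately have "card (p ` S) \<le> card ((\<lambda>k. axis k (1::'a)) ` K)"
    by (intro conjunct2[OF vec.independent_span_bound]) auto
  also have "\<dots> \<le> card K" by (simp add: card_image_le)
  also have "card (p ` S) = card S"
    by (rule card_image[OF inj_on_subset[OF inj vec.span_superset]])
  finally show ?thesis .
qed

theorem theorem14:
  fixes u v w :: "nat \<Rightarrow> 'a::{field, finite} ^ 'n"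
    and D :: "('a ^ 'n) set"
  assumes "ordered_basis u" and "ordered_basis v" and "ordered_basis w"
    and "vec.subspace D"
  shows "card (Supp D) \<ge>
    Max {card I' | I'. I' \<subseteq> {1..CARD('n)} \<and> mu_property u v w I' (m_space w D)}"
proof -
  let ?M = "{card I' | I'. I' \<subseteq> {1..CARD('n)} \<and> mu_property u v w I' (m_space w D)}"
  \<comment> \<open>The empty index set ensures that the maximum is taken over a nonempty
    set.\<close>
  have "mu_property u v w {} (m_space w D)" by (simp add: mu_property_def)
  then have "?M \<noteq> {}" by blast
  moreover have "finite ?M"
    by (rule finite_subset[of _ "card ` Pow {1..CARD('n)}"]) auto
  moreover have "card I' \<le> card (Supp D)"
    if I': "I' \<subseteq> {1..CARD('n)}" and mu: "mu_property u v w I' (m_space w D)" for I'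
  proof -
    have "vec.independent (u ` I')"
      using assms(1) I' unfolding ordered_basis_def
      by (meson image_mono vec.independent_mono)
    then have "card (u ` I') \<le> card (Supp D)"
      using mu_property_span_meets_Supp[OF assms(3) finite_subset[OF I' finite_atLeastAtMost] mu]
      by (rule independent_card_le_of_coordinates)
    moreover have "inj_on u I'"
      using assms(1) I' unfolding ordered_basis_def by (meson inj_on_subset)
    ultimately show ?thesis by (simp add: card_image)
  qed
  ultimately show ?thesis by (subst Max_le_iff) auto
qed

end
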